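(* Let $\epsilon>0$ and let $n\ge 2$ be an integer. For $j=1,\dots,n-1$ let $\rho_j:\mathbb{R}^n\to\mathbb{R}$ be $\rho_j(\mathbf{x})=x_{j+1}-x_j-\epsilon$, and let $\mathbb{R}^n_\epsilon=\bigcap_{j=1}^{n-1}\{\mathbf{x}\in\mathbb{R}^n:\rho_j(\mathbf{x})>0\}$, a connected open subset of $\mathbb{R}^n$. Then there exist smooth vector fields $\vec f_1,\dots,\vec f_m$ on $\mathbb{R}^n$, $m\le n$, such that: (i) each hypersurface $\{\rho_j=0\}$, $j=1,\dots,n-1$, and the open submanifold $\mathbb{R}^n_\epsilon$ are invariant under the flow of each of the vector fields $\pm\vec f_\ell$, $\ell=1,\dots,m$; (ii) the control-affine system $\dot{\mathbf{x}}=\sum_{\ell=1}^m \vec f_\ell(\mathbf{x})\,u_\ell(t)$ is controllable in $\mathbb{R}^n_\epsilon$. Moreover, for every integer $m\le n$ with $2m\ge n+1$, such vector fields $\vec f_1,\dots,\vec f_m$ (satisfying (i) and (ii)) can be constructed so that, for each $\ell=1,\dots,m$, $\vec f_\ell$ depends only on $x_{\ell-1},x_\ell,x_{m+\ell-2}$ and $x_{m+\ell-1}$.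
   Context: Smooth means $C^\infty$; points of $\mathbb{R}^n$ are written $\mathbf{x}=(x_1,\dots,x_n)$. A vector field $\sum_{j=1}^n a_j(\mathbf{x})\,\partial/\partial x_j$ "depends only on" certain coordinates if all its coefficient functions $a_j$ depend only on those coordinates; in the list $x_{\ell-1},x_\ell,x_{m+\ell-2},x_{m+\ell-1}$, any symbol whose index is not in $\{1,\dots,n\}$ is omitted. Invariance: a set $N$ is invariant under the flow of a vector field if every integral curve starting at a point of $N$ stays in $N$ for all times $t\ge 0$ at which it is defined. Controls: the set $\mathcal{U}$ of admissible controls consists of all piecewise smooth functions $\mathbf{u}=(u_1,\dots,u_m):[0,\infty)\to\mathbb{R}^m$ with finitely many discontinuities. For a point $\mathbf{p}$ and $\mathbf{u}\in\mathcal{U}$, $\Gamma(\mathbf{p},t,\mathbf{u})$ denotes the value at time $t$ of the (continuous, piecewise smooth) solution of $\dot{\mathbf{x}}=\sum_{\ell=1}^m\vec f_\ell(\mathbf{x})u_\ell(t)$ with $\mathbf{x}(0)=\mathbf{p}$. Controllability: regarded as a system on the manifold $M=\mathbb{R}^n_\epsilon$, the control system is controllable if for every $\mathbf{p}\in M$ the reachable set $\mathcal{R}_{\mathbf{p}}=\{\Gamma(\mathbf{p},t,\mathbf{u}): t\ge 0,\ \mathbf{u}\in\mathcal{U}\}$ (for the system on $M$) equals $M$. *)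

theory Defs
  imports "HOL-Analysis.Analysis"
begin

text \<open>\<open>C_diff k f\<close> says that \<open>f\<close> is of class \<open>C\<^sup>k\<close> on the whole space; in finite dimension,
  continuity of all iterated directional derivatives is the usual definition.\<close>

primrec C_diff :: "nat \<Rightarrow> ('a::real_normed_vector \<Rightarrow> 'b::real_normed_vector) \<Rightarrow> bool" where
  "C_diff 0 f \<longleftrightarrow> continuous_on UNIV f"
| "C_diff (Suc k) f \<longleftrightarrow> (\<forall>x. f differentiable (at x)) \<and>
     (\<forall>v. C_diff k (\<lambda>x. frechet_derivative f (at x) v))"

definition smooth :: "('a::real_normed_vector \<Rightarrow> 'b::real_normed_vector) \<Rightarrow> bool" where
  "smooth f \<longleftrightarrow> (\<forall>k. C_diff k f)"

text \<open>Throughout, \<open>c :: nat \<Rightarrow> 'n\<close> is a numbering of the coordinates, i.e. a bijection from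
  \<open>{1..CARD('n)}\<close> onto the index type, and the coordinate \<open>x\<^sub>j\<close> of a point \<open>x :: real ^ 'n\<close> is
  \<open>x $ c j\<close>.\<close>

definition rho :: "(nat \<Rightarrow> 'n::finite) \<Rightarrow> real \<Rightarrow> nat \<Rightarrow> real ^ 'n \<Rightarrow> real" where
  "rho c \<epsilon> j x = x $ c (j + 1) - x $ c j - \<epsilon>"

definition R_eps :: "(nat \<Rightarrow> 'n::finite) \<Rightarrow> real \<Rightarrow> (real ^ 'n) set" where
  "R_eps c \<epsilon> = (\<Inter>j\<in>{1..CARD('n) - 1}. {x. rho c \<epsilon> j x > 0})"

definition depends_only_on ::
  "(nat \<Rightarrow> 'n::finite) \<Rightarrow> nat set \<Rightarrow> (real ^ 'n \<Rightarrow> real ^ 'n) \<Rightarrow> bool" where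
  "depends_only_on c J F \<longleftrightarrow>
     (\<forall>x y. (\<forall>j\<in>J \<inter> {1..CARD('n)}. x $ c j = y $ c j) \<longrightarrow> (\<forall>i. F x $ i = F y $ i))"

definition integral_curve ::
  "('a::real_normed_vector \<Rightarrow> 'a) \<Rightarrow> real set \<Rightarrow> (real \<Rightarrow> 'a) \<Rightarrow> bool" where
  "integral_curve F I \<gamma> \<longleftrightarrow> is_interval I \<and> 0 \<in> I \<and>
     (\<forall>t\<in>I. (\<gamma> has_vector_derivative F (\<gamma> t)) (at t within I))"

definition flow_invariant :: "('a::real_normed_vector \<Rightarrow> 'a) \<Rightarrow> 'a set \<Rightarrow> bool" where
  "flow_invariant F N \<longleftrightarrow>
     (\<forall>I \<gamma>. integral_curve F I \<gamma> \<and> \<gamma> 0 \<in> N \<longrightarrow> (\<forall>t\<in>I. t \<ge> 0 \<longrightarrow> \<gamma> t \<in> N))"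

definition preserves_constraints ::
  "(nat \<Rightarrow> 'n::finite) \<Rightarrow> real \<Rightarrow> nat \<Rightarrow> (nat \<Rightarrow> real ^ 'n \<Rightarrow> real ^ 'n) \<Rightarrow> bool" where
  "preserves_constraints c \<epsilon> m f \<longleftrightarrow>
     (\<forall>l\<in>{1..m}. \<forall>F\<in>{f l, \<lambda>x. - f l x}.
        (\<forall>j\<in>{1..CARD('n) - 1}. flow_invariant F {x. rho c \<epsilon> j x = 0}) \<and>
        flow_invariant F (R_eps c \<epsilon>))"

text \<open>Piecewise smoothness of a function on \<open>[0,\<infinity>)\<close>: away from a locally finite set \<open>B\<close> of
  breakpoints it is smooth, and on each piece it extends smoothly past the end points (one-sided
  limits of all derivatives exist). Values at breakpoints are unrestricted, and so are the values
  at negative times.\<close>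

definition piecewise_smooth :: "(real \<Rightarrow> real) \<Rightarrow> bool" where
  "piecewise_smooth u \<longleftrightarrow> (\<exists>B. (\<forall>T. finite (B \<inter> {0..T})) \<and>
     (\<forall>a b. 0 \<le> a \<and> a < b \<and> {a<..<b} \<inter> B = {} \<longrightarrow>
        (\<exists>g. smooth g \<and> (\<forall>t\<in>{a<..<b}. u t = g t))))"

text \<open>An \<open>\<real>\<^sup>m\<close>-valued control is given by its components \<open>u l\<close>, \<open>l \<in> {1..m}\<close>.\<close>

definition admissible_control :: "nat \<Rightarrow> (nat \<Rightarrow> real \<Rightarrow> real) \<Rightarrow> bool" where
  "admissible_control m u \<longleftrightarrow> (\<forall>l\<in>{1..m}. piecewise_smooth (u l) \<and>
     finite {t. t \<ge> 0 \<and> \<not> continuous (at t within {0..}) (u l)})"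

text \<open>\<open>x\<close> is a solution on \<open>[0,T]\<close>, inside \<open>M\<close>, of the control system with initial point \<open>p\<close>.
  The equation may fail at finitely many times, where the control can jump; the continuous
  solution is still unique for smooth \<open>f\<close>, and is then automatically piecewise smooth.\<close>

definition control_solution ::
  "'a::real_normed_vector set \<Rightarrow> nat \<Rightarrow> (nat \<Rightarrow> 'a \<Rightarrow> 'a) \<Rightarrow> 'a \<Rightarrow> (nat \<Rightarrow> real \<Rightarrow> real) \<Rightarrow>
   real \<Rightarrow> (real \<Rightarrow> 'a) \<Rightarrow> bool" where
  "control_solution M m f p u T x \<longleftrightarrow>
     continuous_on {0..T} x \<and> x 0 = p \<and> x ` {0..T} \<subseteq> M \<and>
     (\<exists>S. finite S \<and> (\<forall>t\<in>{0..T} - S.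
        (x has_vector_derivative (\<Sum>l=1..m. u l t *\<^sub>R f l (x t))) (at t within {0..T})))"

text \<open>The set of all values \<open>\<Gamma>(p,t,u)\<close>, over those \<open>t\<close> and \<open>u\<close> for which the solution in \<open>M\<close>
  exists up to time \<open>t\<close>.\<close>

definition reachable ::
  "'a::real_normed_vector set \<Rightarrow> nat \<Rightarrow> (nat \<Rightarrow> 'a \<Rightarrow> 'a) \<Rightarrow> 'a \<Rightarrow> 'a set" where
  "reachable M m f p =
     {x t | x t u. t \<ge> 0 \<and> admissible_control m u \<and> control_solution M m f p u t x}"

definition controllable ::
  "'a::real_normed_vector set \<Rightarrow> nat \<Rightarrow> (nat \<Rightarrow> 'a \<Rightarrow> 'a) \<Rightarrow> bool" where
  "controllable M m f \<longleftrightarrow> (\<forall>p\<in>M. reachable M m f p = M)"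

end

theory Submission
  imports Defs
begin

text \<open>Let \<open>E\<^sub>k = \<partial>\<^sub>k + \<dots> + \<partial>\<^sub>n\<close>, which changes only the gap \<open>\<rho>\<^bsub>k-1\<^esub>\<close> (and, for \<open>k = 1\<close>, none).
  Take the translation field \<open>f\<^sub>1 = E\<^sub>1\<close> and, for \<open>l \<ge> 2\<close>,
  \<open>f\<^sub>l = x\<^bsub>l-1\<^esub> \<rho>\<^bsub>l-1\<^esub> E\<^sub>l + (1 - x\<^bsub>l-1\<^esub>) \<rho>\<^bsub>m+l-2\<^esub> E\<^bsub>m+l-1\<^esub>\<close>, the last term being absent when
  \<open>m + l - 1 > n\<close>. As \<open>x\<^bsub>l-1\<^esub>\<close> is constant along \<open>f\<^sub>l\<close>, each gap is merely multiplied by an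
  exponential, which gives the invariance. The coordinate \<open>x\<^bsub>l-1\<^esub>\<close> acts as a switch: after
  translating to \<open>x\<^bsub>l-1\<^esub> = 1\<close> or \<open>x\<^bsub>l-1\<^esub> = 0\<close>, the flow of \<open>f\<^sub>l\<close> rescales the single gap \<open>l - 1\<close> or
  \<open>m + l - 2\<close>. When \<open>2m \<ge> n + 1\<close> these exhaust all gaps, so piecewise constant controls steer any
  point to any other.\<close>

section \<open>Smooth maps\<close>

text \<open>Order 0 is the continuity of differentiable maps. \<open>C_diff_scaleR\<close> uses this
  to lower the order of whichever factor is not differentiated.\<close>

lemma C_diff_SucD: "C_diff (Suc k) f \<Longrightarrow> C_diff k f"
proof (induction k arbitrary: f)
  case 0
  then show ?case
    by (auto intro!: continuous_at_imp_continuous_on differentiable_imp_continuous_within)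
next
  case (Suc k)
  then show ?case by (metis C_diff.simps(2))
qed

lemma C_diff_const: "C_diff k (\<lambda>x. a)"
  by (induction k arbitrary: a) auto

lemma C_diff_add: "C_diff k f \<Longrightarrow> C_diff k g \<Longrightarrow> C_diff k (\<lambda>x. f x + g x)"
proof (induction k arbitrary: f g)
  case 0
  then show ?case by (auto intro: continuous_on_add)
next
  case (Suc k)
  then have d: "f differentiable (at x)" "g differentiable (at x)" for x by auto
  have "frechet_derivative (\<lambda>x. f x + g x) (at x) v =
      frechet_derivative f (at x) v + frechet_derivative g (at x) v" for x v
    using frechet_derivative_at[OF has_derivative_add[OF d(1)[of x, unfolded frechet_derivative_works]
          d(2)[of x, unfolded frechet_derivative_works]]]
    by metis
  with Suc d show ?case by simp
qed

text \<open>By the product rule each directional derivative is a sum of two products of class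
  \<open>k\<close>. The induction generalises over both factors, since one of them is replaced by
  its derivative.\<close>

lemma C_diff_scaleR:
  fixes f :: "'a::real_normed_vector \<Rightarrow> real"
  shows "C_diff k f \<Longrightarrow> C_diff k g \<Longrightarrow> C_diff k (\<lambda>x. f x *\<^sub>R g x)"
proof (induction k arbitrary: f g)
  case 0
  then show ?case by (auto intro: continuous_on_scaleR)
next
  case (Suc k)
  then have d: "f differentiable (at x)" "g differentiable (at x)" for x by auto
  have "frechet_derivative (\<lambda>x. f x *\<^sub>R g x) (at x) v =
      f x *\<^sub>R frechet_derivative g (at x) v + frechet_derivative f (at x) v *\<^sub>R g x" for x v
    using frechet_derivative_at[OF has_derivative_scaleR[OF d(1)[of x, unfolded frechet_derivative_works]
          d(2)[of x, unfolded frechet_derivative_works]]]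
    by metis
  moreover have "C_diff k (\<lambda>x. f x *\<^sub>R frechet_derivative g (at x) v)" for v
    using Suc.prems by (intro Suc.IH) (auto simp del: C_diff.simps intro: C_diff_SucD, simp)
  moreover have "C_diff k (\<lambda>x. frechet_derivative f (at x) v *\<^sub>R g x)" for v
    using Suc.prems by (intro Suc.IH) (simp, auto simp del: C_diff.simps intro: C_diff_SucD)
  ultimately show ?case using d by (auto intro: C_diff_add)
qed

lemma C_diff_bounded_linear:
  assumes "bounded_linear f"
  shows "C_diff k f"
proof (cases k)
  case 0
  then show ?thesis using assms by (simp add: linear_continuous_on)
next
  case (Suc l)
  have "(f has_derivative f) (at x)" for x
    using assms by (rule bounded_linear_imp_has_derivative)
  with frechet_derivative_at[OF this] show ?thesis
    using Suc by (auto simp: differentiable_def C_diff_const)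
qed

section \<open>Piecewise constant controls\<close>

text \<open>Modelled on \<open>piecewise_smooth\<close>, with free values at the breakpoints; the
  finite set \<open>B\<close> also contains all discontinuities.\<close>

definition piecewise_constant :: "(real \<Rightarrow> 'a) \<Rightarrow> bool" where
  "piecewise_constant u \<longleftrightarrow> (\<exists>B. finite B \<and>
     (\<forall>a b. a < b \<and> {a<..<b} \<inter> B = {} \<longrightarrow> (\<exists>k. \<forall>t\<in>{a<..<b}. u t = k)))"

lemma piecewise_constant_const: "piecewise_constant (\<lambda>t. k)"
  unfolding piecewise_constant_def by (intro exI[of _ "{}"]) auto

lemma piecewise_constant_switch:
  assumes "piecewise_constant u"
  shows "piecewise_constant (\<lambda>t. if t < T then u t else k)"
proof -
  obtain B where B: "finite B"
    "\<And>a b. a < b \<Longrightarrow> {a<..<b} \<inter> B = {} \<Longrightarrow> \<exists>k. \<forall>t\<in>{a<..<b}. u t = k"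
    using assms unfolding piecewise_constant_def by blast
  have "\<exists>k'. \<forall>t\<in>{a<..<b}. (if t < T then u t else k) = k'"
    if ab: "a < b" "{a<..<b} \<inter> insert T B = {}" for a b
  proof -
    obtain k' where k': "\<forall>t\<in>{a<..<b}. u t = k'" using B(2)[of a b] ab by auto
    have "T \<le> a \<or> b \<le> T" using ab by force
    then show ?thesis
    proof
      assume "T \<le> a"
      then show ?thesis by (intro exI[of _ k]) auto
    next
      assume "b \<le> T"
      then show ?thesis using k' by (intro exI[of _ k']) auto
    qed
  qed
  then show ?thesis using B(1) unfolding piecewise_constant_def
    by (intro exI[of _ "insert T B"]) auto
qed

lemma piecewise_constant_smooth:
  fixes u :: "real \<Rightarrow> real"
  assumes "piecewise_constant u"
  shows "piecewise_smooth u"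
proof -
  obtain B where B: "finite B"
    "\<And>a b. a < b \<Longrightarrow> {a<..<b} \<inter> B = {} \<Longrightarrow> \<exists>k. \<forall>t\<in>{a<..<b}. u t = k"
    using assms unfolding piecewise_constant_def by blast
  have "\<exists>g. smooth g \<and> (\<forall>t\<in>{a<..<b}. u t = g t)" if ab: "a < b" "{a<..<b} \<inter> B = {}" for a b
  proof -
    obtain k where "\<forall>t\<in>{a<..<b}. u t = k" using B(2)[OF ab] by blast
    then show ?thesis by (intro exI[of _ "\<lambda>t. k"]) (simp add: smooth_def C_diff_const)
  qed
  then show ?thesis unfolding piecewise_smooth_def using B(1) by (intro exI[of _ B]) auto
qed

lemma piecewise_constant_finite_discontinuities:
  fixes u :: "real \<Rightarrow> 'a::topological_space"
  assumes "piecewise_constant u"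
  shows "finite {t. \<not> isCont u t}"
proof -
  obtain B where B: "finite B"
    "\<And>a b. a < b \<Longrightarrow> {a<..<b} \<inter> B = {} \<Longrightarrow> \<exists>k. \<forall>t\<in>{a<..<b}. u t = k"
    using assms unfolding piecewise_constant_def by blast
  have "isCont u t" if "t \<notin> B" for t
  proof -
    have "open (- B)" using B(1) by (simp add: finite_imp_closed open_Compl)
    with that obtain e where e: "e > 0" "ball t e \<subseteq> - B"
      using openE[of "- B" t] by auto
    then have "{t - e<..<t + e} \<inter> B = {}" by (auto simp: ball_eq_greaterThanLessThan)
    then obtain k where k: "\<forall>s\<in>{t - e<..<t + e}. u s = k"
      using B(2)[of "t - e" "t + e"] e(1) by auto
    have "eventually (\<lambda>s. s \<in> {t - e<..<t + e}) (nhds t)"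
      using e(1) by (intro eventually_nhds_in_open) auto
    then have "eventually (\<lambda>s. u s = k) (nhds t)" by eventually_elim (use k in auto)
    then show ?thesis by (simp add: isCont_cong)
  qed
  then have "{t. \<not> isCont u t} \<subseteq> B" by auto
  then show ?thesis using B(1) finite_subset by blast
qed

lemma admissible_control_piecewise_constant:
  assumes "\<And>l. l \<in> {1..m} \<Longrightarrow> piecewise_constant (u l)"
  shows "admissible_control m u"
  unfolding admissible_control_def
proof (intro ballI conjI)
  fix l assume l: "l \<in> {1..m}"
  show "piecewise_smooth (u l)" using assms[OF l] by (rule piecewise_constant_smooth)
  have "{t. t \<ge> 0 \<and> \<not> continuous (at t within {0..}) (u l)} \<subseteq> {t. \<not> isCont (u l) t}"
    using continuous_within_subset by blast
  then show "finite {t. t \<ge> 0 \<and> \<not> continuous (at t within {0..}) (u l)}"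
    using piecewise_constant_finite_discontinuities[OF assms[OF l]] finite_subset by blast
qed

section \<open>Reachability by concatenating flows\<close>

definition pc_reachable ::
  "'a::real_normed_vector set \<Rightarrow> nat \<Rightarrow> (nat \<Rightarrow> 'a \<Rightarrow> 'a) \<Rightarrow> 'a \<Rightarrow> 'a \<Rightarrow> bool" where
  "pc_reachable M m f p q \<longleftrightarrow> (\<exists>T u x. T \<ge> 0 \<and> (\<forall>l. piecewise_constant (u l)) \<and>
     control_solution M m f p u T x \<and> x T = q)"

lemma pc_reachable_imp_reachable: "pc_reachable M m f p q \<Longrightarrow> q \<in> reachable M m f p"
  unfolding pc_reachable_def reachable_def
  using admissible_control_piecewise_constant by blast

lemma pc_reachable_refl:
  assumes "p \<in> M"
  shows "pc_reachable M m f p p"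
  unfolding pc_reachable_def control_solution_def
  using assms
  \<comment> \<open>For \<open>T = 0\<close> the exceptional set \<open>{0}\<close> removes the only
    time, so the differential equation is vacuous.\<close>
  by (intro exI[of _ 0] exI[of _ "\<lambda>l t. 0"] exI[of _ "\<lambda>t. p"])
     (auto simp: piecewise_constant_const intro!: exI[of _ "{0}"])

text \<open>One unit of time along \<open>k *\<^sub>R f l\<close> is appended to a given trajectory.
  The sign of \<open>k\<close> is free, so flows can be followed in both directions.\<close>

lemma pc_reachable_flow:
  assumes "pc_reachable M m f p (\<gamma> 0)" and l: "l \<in> {1..m}"
    and \<gamma>: "\<And>t. t \<in> {0..1} \<Longrightarrow> (\<gamma> has_vector_derivative k *\<^sub>R f l (\<gamma> t)) (at t)"
    and M: "\<gamma> ` {0..1} \<subseteq> M"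
  shows "pc_reachable M m f p (\<gamma> 1)"
proof -
  obtain T u x where T: "T \<ge> 0" and u: "\<And>i. piecewise_constant (u i)"
    and "control_solution M m f p u T x" and xT: "x T = \<gamma> 0"
    using assms(1) unfolding pc_reachable_def by blast
  then obtain S where x: "continuous_on {0..T} x" "x 0 = p" "x ` {0..T} \<subseteq> M" and S: "finite S"
    "\<And>t. t \<in> {0..T} - S \<Longrightarrow>
       (x has_vector_derivative (\<Sum>i=1..m. u i t *\<^sub>R f i (x t))) (at t within {0..T})"
    unfolding control_solution_def by blast
  \<comment> \<open>After time \<open>T\<close> only the field \<open>f l\<close> is switched on,
    with constant control \<open>k\<close>; \<open>y\<close> follows \<open>\<gamma>\<close> shifted
    by \<open>T\<close>.\<close>
  define v where "v i t = (if t < T then u i t else if i = l then k else 0)" for i t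
  define y where "y t = (if t \<le> T then x t else \<gamma> (t - T))" for t
  have v: "piecewise_constant (v i)" for i
    unfolding v_def by (rule piecewise_constant_switch[OF u])
  have "continuous_on ({0..T} \<union> {T..T+1}) y"
    unfolding y_def
  proof (rule continuous_on_cases)
    show "continuous_on {T..T + 1} (\<lambda>t. \<gamma> (t - T))"
    proof (rule continuous_on_compose2[of "{0..1}" \<gamma>])
      show "continuous_on {0..1} \<gamma>"
        using has_vector_derivative_continuous[OF \<gamma>] by (intro continuous_at_imp_continuous_on) auto
    qed (auto intro!: continuous_intros)
  qed (use x xT in auto)
  moreover have split: "{0..T} \<union> {T..T+1} = {0..T+1}" using T by auto
  moreover have "y ` {0..T+1} \<subseteq> M"
    unfolding y_def using x(3) M by auto
  \<comment> \<open>The one-sided derivatives may differ at the junction, so \<open>T\<close> joins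
    the exceptional times.\<close>
  moreover have "(y has_vector_derivative (\<Sum>i=1..m. v i t *\<^sub>R f i (y t))) (at t within {0..T+1})"
    if t: "t \<in> {0..T+1} - insert T S" for t
  proof (cases "t < T")
    case True
    \<comment> \<open>Both intervals have the same trace on the neighbourhood \<open>{..<T}\<close>
      of \<open>t\<close>.\<close>
    have "at t within {0..T} = at t within {0..T+1}"
      by (rule at_within_nhd[of t "{..<T}"]) (use True in auto)
    then have "(x has_vector_derivative (\<Sum>i=1..m. v i t *\<^sub>R f i (y t))) (at t within {0..T+1})"
      using S(2)[of t] t True by (simp add: v_def y_def)
    then show ?thesis
      by (rule has_vector_derivative_transform_within[of _ _ _ _ "T - t"])
        (use t True in \<open>auto simp: y_def dist_real_def\<close>)
  next
    case False
    have sum: "(\<Sum>i=1..m. v i t *\<^sub>R f i (y t)) = k *\<^sub>R f l (\<gamma> (t - T))"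
      using False t l by (simp add: v_def y_def if_distrib[of "\<lambda>a. a *\<^sub>R _"] cong: if_cong)
    have "(\<gamma> has_vector_derivative k *\<^sub>R f l (\<gamma> (t - T))) (at (t - T))"
      using False t by (intro \<gamma>) auto
    then have "((\<gamma> \<circ> (\<lambda>t. t - T)) has_vector_derivative 1 *\<^sub>R (k *\<^sub>R f l (\<gamma> (t - T)))) (at t)"
      by (intro vector_diff_chain_at) (auto intro!: derivative_eq_intros)
    then have "((\<lambda>t. \<gamma> (t - T)) has_vector_derivative (\<Sum>i=1..m. v i t *\<^sub>R f i (y t)))
        (at t within {0..T+1})"
      unfolding sum o_def by (simp add: has_vector_derivative_at_within)
    then show ?thesis
      by (rule has_vector_derivative_transform_within[of _ _ _ _ "t - T"])
        (use t False in \<open>auto simp: y_def dist_real_def\<close>)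
  qed
  moreover have "y 0 = p" using T x(2) by (simp add: y_def)
  ultimately have "control_solution M m f p v (T + 1) y"
    unfolding control_solution_def using S(1) by (metis finite_insert)
  moreover have "y (T + 1) = \<gamma> 1" by (simp add: y_def)
  ultimately show ?thesis unfolding pc_reachable_def using T v
    by (intro exI[of _ "T + 1"] exI[of _ v] exI[of _ y]) auto
qed

text \<open>Multiplying by the integrating factor \<open>exp (- g * s)\<close> gives a function with
  zero derivative, hence a constant on the interval.\<close>

lemma exponential_growth:
  fixes r :: "real \<Rightarrow> real"
  assumes "is_interval I" "0 \<in> I" "t \<in> I"
    and "\<And>s. s \<in> I \<Longrightarrow> (r has_vector_derivative g * r s) (at s within I)"
  shows "r t = r 0 * exp (g * t)"
proof -
  have "((\<lambda>s. r s * exp (- g * s)) has_vector_derivative 0) (at s within I)" if "s \<in> I" for s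
    using assms(4)[OF that] unfolding has_real_derivative_iff_has_vector_derivative[symmetric]
    by (auto intro!: derivative_eq_intros simp: algebra_simps)
  then obtain a where "\<And>s. s \<in> I \<Longrightarrow> r s * exp (- g * s) = a"
    using has_vector_derivative_zero_constant[of I "\<lambda>s. r s * exp (- g * s)"] assms(1)
    using is_interval_convex by blast
  from this[OF assms(2)] this[OF assms(3)] have "r t * exp (- g * t) = r 0" by simp
  then show ?thesis by (simp add: exp_minus field_simps)
qed

section \<open>The vector fields\<close>

text \<open>This is the constant field \<open>E\<^sub>k\<close>. For \<open>k > CARD('n)\<close> the
  index range is empty and the vector is 0, which makes the second term of \<open>gap_field\<close>
  vanish without a case distinction, even though \<open>rho\<close> then refers to values of
  \<open>c\<close> outside the numbering.\<close>

definition tail_vec :: "(nat \<Rightarrow> 'n::finite) \<Rightarrow> nat \<Rightarrow> real ^ 'n" where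
  "tail_vec c k = (\<chi> i. if i \<in> c ` {k..CARD('n)} then 1 else 0)"

definition gap_field ::
  "(nat \<Rightarrow> 'n::finite) \<Rightarrow> real \<Rightarrow> nat \<Rightarrow> nat \<Rightarrow> real ^ 'n \<Rightarrow> real ^ 'n" where
  "gap_field c \<epsilon> m l x = (if l = 1 then tail_vec c 1 else
     x $ c (l - 1) *\<^sub>R rho c \<epsilon> (l - 1) x *\<^sub>R tail_vec c l +
     (1 - x $ c (l - 1)) *\<^sub>R rho c \<epsilon> (m + l - 2) x *\<^sub>R tail_vec c (m + l - 1))"

lemma smooth_gap_field: "smooth (gap_field c \<epsilon> m l)"
proof -
  have coord: "C_diff k (\<lambda>x::real^'n. x $ i)" for k i
    by (rule C_diff_bounded_linear[OF bounded_linear_vec_nth])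
  have scale: "C_diff k (\<lambda>x. a * g x)" if "C_diff k g" for k a and g :: "real^'n \<Rightarrow> real"
    using C_diff_scaleR[OF C_diff_const that] by simp
  have rho: "C_diff k (rho c \<epsilon> j)" for k j
    using C_diff_add[OF C_diff_add[OF coord[of k "c (j + 1)"] scale[OF coord[of k "c j"], of "-1"]]
        C_diff_const[of k "- \<epsilon>"]]
    by (simp add: rho_def[abs_def])
  have mult: "C_diff k (\<lambda>x. f x * g x)" if "C_diff k f" "C_diff k g" for k and f g :: "real^'n \<Rightarrow> real"
    using C_diff_scaleR[OF that] by simp
  have sub: "C_diff k (\<lambda>x::real^'n. 1 - x $ i)" for k i
    using C_diff_add[OF C_diff_const[of k 1] scale[OF coord[of k i], of "-1"]] by simp
  show ?thesis
    unfolding smooth_def gap_field_def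
    by (cases "l = 1") (auto intro!: C_diff_const C_diff_add C_diff_scaleR coord rho sub mult)
qed

section \<open>Action of the fields on the gaps, and invariance of the constraints\<close>

locale numbering =
  fixes c :: "nat \<Rightarrow> 'n::finite"
  assumes bij: "bij_betw c {1..CARD('n)} UNIV"
begin

lemma tail_vec_nth: "j \<in> {1..CARD('n)} \<Longrightarrow> k \<ge> 1 \<Longrightarrow> tail_vec c k $ c j = (if k \<le> j then 1 else 0)"
  using bij_betw_imp_inj_on[OF bij] by (auto simp: tail_vec_def dest: inj_onD)

lemma vec_eqI:
  assumes "\<And>j. j \<in> {1..CARD('n)} \<Longrightarrow> x $ c j = y $ c j"
  shows "x = y"
  using assms bij_betw_imp_surj_on[OF bij] by (metis UNIV_I imageE vec_eq_iff)

text \<open>Coordinates \<open>j\<close> and \<open>j + 1\<close> move together unless the tail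
  starts exactly at \<open>j + 1\<close>. In particular \<open>k = 1\<close> is a translation that
  changes no gap.\<close>

lemma rho_tail_vec:
  assumes "j \<in> {1..CARD('n) - 1}" "k \<ge> 1"
  shows "rho c \<epsilon> j (x + a *\<^sub>R tail_vec c k) = rho c \<epsilon> j x + (if k = j + 1 then a else 0)"
proof -
  have "j + 1 \<in> {1..CARD('n)}" "j \<in> {1..CARD('n)}" using assms(1) by auto
  from this[THEN tail_vec_nth[OF _ assms(2)]] show ?thesis by (auto simp: rho_def algebra_simps)
qed

lemma tail_vec_beyond: "k > CARD('n) \<Longrightarrow> tail_vec c k = 0"
  by (simp add: tail_vec_def vec_eq_iff)

text \<open>The left side is the derivative of \<open>rho c \<epsilon> j\<close> along the field. It
  is proportional to the gap itself, with a factor that involves only the pivot coordinate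
  \<open>x $ c (l - 1)\<close>.\<close>

lemma gap_field_rate:
  assumes "l \<in> {1..m}" "m \<ge> 2" "j \<in> {1..CARD('n) - 1}"
  shows "gap_field c \<epsilon> m l x $ c (j + 1) - gap_field c \<epsilon> m l x $ c j =
    (if l = 1 then 0 else if j = l - 1 then x $ c (l - 1)
     else if j = m + l - 2 then 1 - x $ c (l - 1) else 0) * rho c \<epsilon> j x"
proof -
  have "j + 1 \<in> {1..CARD('n)}" "j \<in> {1..CARD('n)}" using assms by auto
  then have tail: "tail_vec c k $ c (j + 1) - tail_vec c k $ c j = (if k = j + 1 then 1 else 0)"
    if "k \<ge> 1" for k
    using that by (auto simp: tail_vec_nth)
  show ?thesis
  proof (cases "l = 1")
    case True
    then show ?thesis using tail[of 1] assms(3) by (simp add: gap_field_def)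
  next
    case False
    have "gap_field c \<epsilon> m l x $ c (j + 1) - gap_field c \<epsilon> m l x $ c j =
        x $ c (l - 1) * rho c \<epsilon> (l - 1) x * (tail_vec c l $ c (j + 1) - tail_vec c l $ c j) +
        (1 - x $ c (l - 1)) * rho c \<epsilon> (m + l - 2) x *
          (tail_vec c (m + l - 1) $ c (j + 1) - tail_vec c (m + l - 1) $ c j)"
      using False unfolding gap_field_def by (simp add: right_diff_distrib)
    also have "\<dots> = x $ c (l - 1) * rho c \<epsilon> (l - 1) x * (if j = l - 1 then 1 else 0) +
        (1 - x $ c (l - 1)) * rho c \<epsilon> (m + l - 2) x * (if j = m + l - 2 then 1 else 0)"
    proof -
      have "l \<ge> 1" "m + l - 1 \<ge> 1" "l = j + 1 \<longleftrightarrow> j = l - 1"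
        "m + l - 1 = j + 1 \<longleftrightarrow> j = m + l - 2"
        using assms False by auto
      then show ?thesis by (simp only: tail)
    qed
    finally have "gap_field c \<epsilon> m l x $ c (j + 1) - gap_field c \<epsilon> m l x $ c j =
        x $ c (l - 1) * rho c \<epsilon> (l - 1) x * (if j = l - 1 then 1 else 0) +
        (1 - x $ c (l - 1)) * rho c \<epsilon> (m + l - 2) x * (if j = m + l - 2 then 1 else 0)" .
    \<comment> \<open>The two terms drive different gaps because \<open>m \<ge> 2\<close>, so at
      most one of the two conditions on \<open>j\<close> holds.\<close>
    moreover have "l - 1 \<noteq> m + l - 2" using assms False by auto
    ultimately show ?thesis using False by simp
  qed
qed

text \<open>Both tails start at index \<open>l\<close> or later, so the pivot coordinate is
  untouched.\<close>

lemma gap_field_pivot: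
  assumes "l \<in> {1..m}" "l \<noteq> 1" "m \<le> CARD('n)"
  shows "gap_field c \<epsilon> m l x $ c (l - 1) = 0"
proof -
  have "l - 1 \<in> {1..CARD('n)}" using assms by auto
  from tail_vec_nth[OF this] show ?thesis using assms by (auto simp: gap_field_def)
qed

text \<open>Freezing the pivot at its initial value turns the gap equation into a linear one with
  constant rate. The scalar \<open>s\<close> treats both signs of the field at once.\<close>

lemma rho_integral_curve:
  assumes "l \<in> {1..m}" "m \<ge> 2" "m \<le> CARD('n)" "j \<in> {1..CARD('n) - 1}"
    and ic: "integral_curve (\<lambda>x. s *\<^sub>R gap_field c \<epsilon> m l x) I \<gamma>"
  obtains g where "\<And>t. t \<in> I \<Longrightarrow> rho c \<epsilon> j (\<gamma> t) = rho c \<epsilon> j (\<gamma> 0) * exp (g * t)"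
proof -
  have I: "is_interval I" "0 \<in> I" using ic by (auto simp: integral_curve_def)
  have nth: "((\<lambda>t. \<gamma> t $ i) has_vector_derivative s * gap_field c \<epsilon> m l (\<gamma> t) $ i) (at t within I)"
    if "t \<in> I" for t i
    using bounded_linear.has_vector_derivative[OF bounded_linear_vec_nth[of i]] ic that
    unfolding integral_curve_def by fastforce
  have pivot: "\<gamma> t $ c (l - 1) = \<gamma> 0 $ c (l - 1)" if "l \<noteq> 1" "t \<in> I" for t
  proof -
    \<comment> \<open>Constancy is growth with rate 0.\<close>
    have "\<gamma> t $ c (l - 1) = \<gamma> 0 $ c (l - 1) * exp (0 * t)"
      by (rule exponential_growth[OF I that(2)])
        (use nth[of _ "c (l - 1)"] gap_field_pivot[of l m] assms that in simp)
    then show ?thesis by simp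
  qed
  define g where "g = s * (if l = 1 then 0 else if j = l - 1 then \<gamma> 0 $ c (l - 1)
     else if j = m + l - 2 then 1 - \<gamma> 0 $ c (l - 1) else 0)"
  have "((\<lambda>t. rho c \<epsilon> j (\<gamma> t)) has_vector_derivative g * rho c \<epsilon> j (\<gamma> t)) (at t within I)"
    if t: "t \<in> I" for t
  proof -
    have "((\<lambda>t. \<gamma> t $ c (j + 1) - \<gamma> t $ c j - \<epsilon>) has_vector_derivative
        s * gap_field c \<epsilon> m l (\<gamma> t) $ c (j + 1) - s * gap_field c \<epsilon> m l (\<gamma> t) $ c j - 0)
        (at t within I)"
      by (intro has_vector_derivative_diff nth t has_vector_derivative_const)
    moreover have "s * gap_field c \<epsilon> m l (\<gamma> t) $ c (j + 1) - s * gap_field c \<epsilon> m l (\<gamma> t) $ c j - 0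
        = s * (gap_field c \<epsilon> m l (\<gamma> t) $ c (j + 1) - gap_field c \<epsilon> m l (\<gamma> t) $ c j)"
      by (simp only: right_diff_distrib diff_0_right)
    moreover have "\<dots> = g * rho c \<epsilon> j (\<gamma> t)"
      unfolding gap_field_rate[OF assms(1,2,4)] g_def using pivot[OF _ t] by auto
    ultimately show ?thesis unfolding rho_def by simp
  qed
  from exponential_growth[OF I _ this] show ?thesis by (rule that)
qed

text \<open>Multiplication by an exponential keeps a zero gap zero and a positive gap positive;
  \<open>s = 1\<close> and \<open>s = -1\<close> give the two signs.\<close>

lemma preserves_constraints_gap_field:
  assumes "m \<ge> 2" "m \<le> CARD('n)"
  shows "preserves_constraints c \<epsilon> m (gap_field c \<epsilon> m)"
proof -
  have "(\<forall>j\<in>{1..CARD('n) - 1}. flow_invariant (\<lambda>x. s *\<^sub>R gap_field c \<epsilon> m l x) {x. rho c \<epsilon> j x = 0}) \<and>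
        flow_invariant (\<lambda>x. s *\<^sub>R gap_field c \<epsilon> m l x) (R_eps c \<epsilon>)" if l: "l \<in> {1..m}" for s l
  proof -
    have growth: "\<exists>g. \<forall>t\<in>I. rho c \<epsilon> j (\<gamma> t) = rho c \<epsilon> j (\<gamma> 0) * exp (g * t)"
      if "integral_curve (\<lambda>x. s *\<^sub>R gap_field c \<epsilon> m l x) I \<gamma>" "j \<in> {1..CARD('n) - 1}" for I \<gamma> j
      using rho_integral_curve[OF l assms that(2,1)] by metis
    have "flow_invariant (\<lambda>x. s *\<^sub>R gap_field c \<epsilon> m l x) {x. rho c \<epsilon> j x = 0}"
      if "j \<in> {1..CARD('n) - 1}" for j
      unfolding flow_invariant_def mem_Collect_eq
    proof (intro allI impI ballI, elim conjE)
      fix I \<gamma> t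
      assume "integral_curve (\<lambda>x. s *\<^sub>R gap_field c \<epsilon> m l x) I \<gamma>" "t \<in> I" "rho c \<epsilon> j (\<gamma> 0) = 0"
      with growth[OF this(1) that] show "rho c \<epsilon> j (\<gamma> t) = 0" by auto
    qed
    moreover have "flow_invariant (\<lambda>x. s *\<^sub>R gap_field c \<epsilon> m l x) (R_eps c \<epsilon>)"
      unfolding flow_invariant_def R_eps_def INT_iff mem_Collect_eq
    proof (intro allI impI ballI, elim conjE)
      fix I \<gamma> t j
      assume "integral_curve (\<lambda>x. s *\<^sub>R gap_field c \<epsilon> m l x) I \<gamma>" "t \<in> I"
        and j: "j \<in> {1..CARD('n) - 1}" "\<forall>j\<in>{1..CARD('n) - 1}. rho c \<epsilon> j (\<gamma> 0) > 0"
      with growth[OF this(1) j(1)] show "rho c \<epsilon> j (\<gamma> t) > 0" by auto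
    qed
    ultimately show ?thesis by simp
  qed
  from this[of _ 1] this[of _ "-1"] show ?thesis unfolding preserves_constraints_def by simp
qed

lemma depends_only_on_gap_field:
  assumes "l \<in> {1..m}" "m \<ge> 2" "m \<le> CARD('n)"
  shows "depends_only_on c {l - 1, l, m + l - 2, m + l - 1} (gap_field c \<epsilon> m l)"
  unfolding depends_only_on_def
proof (intro allI impI)
  fix x y :: "real ^ 'n" and i
  assume eq: "\<forall>j\<in>{l - 1, l, m + l - 2, m + l - 1} \<inter> {1..CARD('n)}. x $ c j = y $ c j"
  show "gap_field c \<epsilon> m l x $ i = gap_field c \<epsilon> m l y $ i"
  proof (cases "l = 1")
    case True
    then show ?thesis by (simp add: gap_field_def)
  next
    case False
    then have l: "x $ c (l - 1) = y $ c (l - 1)" "x $ c (l - 1 + 1) = y $ c (l - 1 + 1)"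
    proof -
      have "l - 1 \<in> {1..CARD('n)}" "l \<in> {1..CARD('n)}" "l - 1 + 1 = l" using False assms by auto
      then show "x $ c (l - 1) = y $ c (l - 1)" "x $ c (l - 1 + 1) = y $ c (l - 1 + 1)"
        using eq by auto
    qed
    have "rho c \<epsilon> (m + l - 2) x = rho c \<epsilon> (m + l - 2) y" if "m + l - 1 \<le> CARD('n)"
    proof -
      have "m + l - 2 + 1 = m + l - 1" "m + l - 2 \<in> {1..CARD('n)}" "m + l - 1 \<in> {1..CARD('n)}"
        using False assms that by auto
      then show ?thesis using eq unfolding rho_def by simp
    qed
    \<comment> \<open>Here the second gap may refer to a coordinate outside the numbering, but it
      multiplies the zero vector.\<close>
    moreover have "tail_vec c (m + l - 1) = 0" if "\<not> m + l - 1 \<le> CARD('n)"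
      using that by (simp add: tail_vec_beyond)
    ultimately show ?thesis using False l by (cases "m + l - 1 \<le> CARD('n)") (auto simp: gap_field_def rho_def)
  qed
qed

section \<open>Controllability\<close>

lemma R_eps_translate: "x \<in> R_eps c \<epsilon> \<Longrightarrow> x + a *\<^sub>R tail_vec c 1 \<in> R_eps c \<epsilon>"
  unfolding R_eps_def using rho_tail_vec[of _ 1] by auto

text \<open>The displacement multiplies gap \<open>j\<close> by \<open>exp a\<close> and keeps all
  other gaps.\<close>

lemma R_eps_scale_gap:
  assumes "x \<in> R_eps c \<epsilon>" "j \<in> {1..CARD('n) - 1}"
  shows "x + ((exp a - 1) * rho c \<epsilon> j x) *\<^sub>R tail_vec c (j + 1) \<in> R_eps c \<epsilon>"
proof -
  have "rho c \<epsilon> i (x + ((exp a - 1) * rho c \<epsilon> j x) *\<^sub>R tail_vec c (j + 1)) > 0"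
    if "i \<in> {1..CARD('n) - 1}" for i
  proof -
    have "rho c \<epsilon> i x > 0" using assms(1) that by (simp add: R_eps_def)
    then show ?thesis using rho_tail_vec[OF that, of "j + 1"] by (auto simp: left_diff_distrib)
  qed
  then show ?thesis by (simp add: R_eps_def)
qed

context
  fixes m :: nat and \<epsilon> :: real
  assumes m: "m \<ge> 2" "m \<le> CARD('n)" "2 * m \<ge> CARD('n) + 1"
begin

abbreviation "pcr \<equiv> pc_reachable (R_eps c \<epsilon>) m (gap_field c \<epsilon> m)"

lemma reach_translate:
  assumes "pcr p q" "q \<in> R_eps c \<epsilon>"
  shows "pcr p (q + a *\<^sub>R tail_vec c 1)"
proof -
  define \<gamma> where "\<gamma> t = q + (t * a) *\<^sub>R tail_vec c 1" for t
  have "pcr p (\<gamma> 1)"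
  proof (rule pc_reachable_flow)
    show "1 \<in> {1..m}" using m by simp
    show "(\<gamma> has_vector_derivative a *\<^sub>R gap_field c \<epsilon> m 1 (\<gamma> t)) (at t)" for t
      unfolding \<gamma>_def by (auto intro!: derivative_eq_intros simp: gap_field_def)
    show "\<gamma> ` {0..1} \<subseteq> R_eps c \<epsilon>" using assms(2) R_eps_translate by (auto simp: \<gamma>_def)
  qed (use assms(1) in \<open>simp add: \<gamma>_def\<close>)
  then show ?thesis by (simp add: \<gamma>_def)
qed

text \<open>At pivot value 1 or 0 one term of the field drops out, leaving the linear scaling of gap
  \<open>j\<close>, whose flow is explicit.\<close>

lemma reach_scale_at_pivot:
  assumes "pcr p q" "q \<in> R_eps c \<epsilon>" "l \<in> {2..m}" and j: "j \<in> {1..CARD('n) - 1}"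
    and piv: "j = l - 1 \<and> q $ c (l - 1) = 1 \<or> j = m + l - 2 \<and> q $ c (l - 1) = 0"
  shows "pcr p (q + ((exp a - 1) * rho c \<epsilon> j q) *\<^sub>R tail_vec c (j + 1))"
proof -
  define \<gamma> where "\<gamma> t = q + ((exp (t * a) - 1) * rho c \<epsilon> j q) *\<^sub>R tail_vec c (j + 1)" for t
  have M: "\<gamma> t \<in> R_eps c \<epsilon>" for t
    unfolding \<gamma>_def by (rule R_eps_scale_gap[OF assms(2) j])
  have rho: "rho c \<epsilon> j (\<gamma> t) = exp (t * a) * rho c \<epsilon> j q" for t
    unfolding \<gamma>_def using rho_tail_vec[OF j, of "j + 1"] by (simp add: left_diff_distrib)
  \<comment> \<open>The pivot lies before the moving tail, so the switch stays set along the whole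
    curve.\<close>
  have "l - 1 \<in> {1..CARD('n)}" "l - 1 < j + 1" using assms m by auto
  then have pivot: "\<gamma> t $ c (l - 1) = q $ c (l - 1)" for t
    unfolding \<gamma>_def by (simp add: tail_vec_nth)
  have field: "gap_field c \<epsilon> m l (\<gamma> t) = rho c \<epsilon> j (\<gamma> t) *\<^sub>R tail_vec c (j + 1)" for t
  proof -
    have "m + l - 2 + 1 = m + l - 1" "l - 1 + 1 = l" "l \<noteq> 1" using m assms(3) by auto
    then show ?thesis using piv pivot[of t] by (auto simp: gap_field_def simp del: Suc_eq_plus1)
  qed
  have "pcr p (\<gamma> 1)"
  proof (rule pc_reachable_flow)
    show "l \<in> {1..m}" using assms(3) by auto
    show "(\<gamma> has_vector_derivative a *\<^sub>R gap_field c \<epsilon> m l (\<gamma> t)) (at t)" for t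
      unfolding field rho unfolding \<gamma>_def
      by (auto intro!: derivative_eq_intros simp: algebra_simps)
    show "\<gamma> ` {0..1} \<subseteq> R_eps c \<epsilon>" using M by auto
  qed (use assms(1) in \<open>simp add: \<gamma>_def\<close>)
  then show ?thesis by (simp add: \<gamma>_def)
qed

text \<open>Translate to set the switch, scale the gap, and translate back; translations leave every
  gap unchanged.\<close>

lemma reach_scale:
  assumes q: "pcr p q" "q \<in> R_eps c \<epsilon>" and j: "j \<in> {1..CARD('n) - 1}"
  shows "pcr p (q + ((exp a - 1) * rho c \<epsilon> j q) *\<^sub>R tail_vec c (j + 1))"
proof -
  \<comment> \<open>Gaps below \<open>m\<close> are the first gap of field \<open>j + 1\<close>, the
    others the second gap of field \<open>j + 2 - m\<close>. The latter index is at most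
    \<open>m\<close> because \<open>j \<le> CARD('n) - 1 \<le> 2 * m - 2\<close>.\<close>
  define l where "l = (if j < m then j + 1 else j + 2 - m)"
  define b where "b = (if j < m then 1 else 0) - q $ c (l - 1)"
  have l: "l \<in> {2..m}" "if j < m then j = l - 1 else j = m + l - 2"
    using j m by (auto simp: l_def)
  define q' where "q' = q + b *\<^sub>R tail_vec c 1"
  have q': "pcr p q'" "q' \<in> R_eps c \<epsilon>"
    unfolding q'_def by (rule reach_translate[OF q] R_eps_translate[OF q(2)])+
  have "l - 1 \<in> {1..CARD('n)}" using l m by auto
  then have "q' $ c (l - 1) = (if j < m then 1 else 0)"
    by (auto simp: q'_def b_def tail_vec_nth)
  moreover have "rho c \<epsilon> j q' = rho c \<epsilon> j q"
    unfolding q'_def using j rho_tail_vec[OF j, of 1] by simp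
  ultimately have "pcr p (q' + ((exp a - 1) * rho c \<epsilon> j q) *\<^sub>R tail_vec c (j + 1))"
    using reach_scale_at_pivot[OF q' l(1) j, of a] l(2) by (auto split: if_splits)
  moreover have "q' + ((exp a - 1) * rho c \<epsilon> j q) *\<^sub>R tail_vec c (j + 1) \<in> R_eps c \<epsilon>"
    using R_eps_scale_gap[OF q'(2) j, of a] \<open>rho c \<epsilon> j q' = rho c \<epsilon> j q\<close> by simp
  ultimately show ?thesis
    using reach_translate[of p _ "- b"] by (fastforce simp: q'_def algebra_simps)
qed

text \<open>The gaps are corrected one at a time; each scaling leaves those already matched
  intact.\<close>

lemma reach_match_gaps:
  assumes "p \<in> R_eps c \<epsilon>" "q \<in> R_eps c \<epsilon>" "k \<le> CARD('n) - 1"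
  shows "\<exists>r\<in>R_eps c \<epsilon>. pcr p r \<and> (\<forall>j\<in>{1..k}. rho c \<epsilon> j r = rho c \<epsilon> j q)"
  using assms(3)
proof (induction k)
  case 0
  show ?case using pc_reachable_refl[OF assms(1)] assms(1) by (intro bexI[of _ p]) auto
next
  case (Suc k)
  then obtain r where r: "r \<in> R_eps c \<epsilon>" "pcr p r" "\<And>j. j \<in> {1..k} \<Longrightarrow> rho c \<epsilon> j r = rho c \<epsilon> j q"
    by auto
  have j: "Suc k \<in> {1..CARD('n) - 1}" using Suc.prems by simp
  then have pos: "rho c \<epsilon> (Suc k) r > 0" "rho c \<epsilon> (Suc k) q > 0"
    using r(1) assms(2) unfolding R_eps_def by auto
  \<comment> \<open>Both gaps are positive, so \<open>exp a\<close> is the ratio of target to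
    current gap.\<close>
  define a where "a = ln (rho c \<epsilon> (Suc k) q / rho c \<epsilon> (Suc k) r)"
  define r' where "r' = r + ((exp a - 1) * rho c \<epsilon> (Suc k) r) *\<^sub>R tail_vec c (Suc k + 1)"
  have "pcr p r'" "r' \<in> R_eps c \<epsilon>"
    unfolding r'_def by (rule reach_scale[OF r(2,1) j] R_eps_scale_gap[OF r(1) j])+
  moreover have "rho c \<epsilon> i r' = rho c \<epsilon> i q" if i: "i \<in> {1..Suc k}" for i
  proof -
    have "i \<in> {1..CARD('n) - 1}" using i j by auto
    from rho_tail_vec[OF this] have "rho c \<epsilon> i r' = rho c \<epsilon> i r +
        (if Suc k = i then (exp a - 1) * rho c \<epsilon> (Suc k) r else 0)"
      unfolding r'_def by simp
    then show ?thesis using i r(3)[of i] pos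
      by (cases "i = Suc k") (auto simp: a_def field_simps)
  qed
  ultimately show ?case by blast
qed

lemma controllable_gap_field: "controllable (R_eps c \<epsilon>) m (gap_field c \<epsilon> m)"
proof -
  have "q \<in> reachable (R_eps c \<epsilon>) m (gap_field c \<epsilon> m) p"
    if pq: "p \<in> R_eps c \<epsilon>" "q \<in> R_eps c \<epsilon>" for p q
  proof -
    obtain r where r: "r \<in> R_eps c \<epsilon>" "pcr p r"
      "\<And>j. j \<in> {1..CARD('n) - 1} \<Longrightarrow> rho c \<epsilon> j r = rho c \<epsilon> j q"
      using reach_match_gaps[OF pq order_refl] by blast
    \<comment> \<open>With all gaps equal, the offset of the first coordinate propagates to every
      coordinate, and one final translation reaches \<open>q\<close>.\<close>
    define a where "a = q $ c 1 - r $ c 1"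
    have "q $ c j = r $ c j + a" if "1 \<le> j" "j \<le> CARD('n)" for j
      using that
    proof (induction j rule: dec_induct)
      case base
      then show ?case by (simp add: a_def)
    next
      case (step i)
      then show ?case using r(3)[of i] by (simp add: rho_def)
    qed
    then have "q = r + a *\<^sub>R tail_vec c 1" by (intro vec_eqI) (auto simp: tail_vec_nth)
    then show ?thesis using reach_translate[OF r(2,1)] pc_reachable_imp_reachable by blast
  qed
  moreover have "reachable (R_eps c \<epsilon>) m (gap_field c \<epsilon> m) p \<subseteq> R_eps c \<epsilon>" for p
    unfolding reachable_def control_solution_def by force
  ultimately show ?thesis unfolding controllable_def by blast
qed

end

end

section \<open>Topology of the region, and the final theorem\<close>

lemma open_R_eps: "open (R_eps c \<epsilon>)"
  unfolding R_eps_def rho_def by (intro open_INT ballI open_Collect_less continuous_intros) auto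

text \<open>The region is an intersection of open half-spaces; convexity yields its
  connectedness.\<close>

lemma convex_R_eps: "convex (R_eps c \<epsilon>)"
proof -
  have "convex {x. rho c \<epsilon> j x > 0}" for j
  proof -
    have "{x. rho c \<epsilon> j x > 0} = {x. (axis (c (j + 1)) 1 - axis (c j) 1) \<bullet> x > \<epsilon>}"
      by (auto simp: rho_def inner_diff_left inner_axis')
    then show ?thesis by (simp only: convex_halfspace_gt)
  qed
  then show ?thesis unfolding R_eps_def by (intro convex_INT)
qed

theorem theorem1p1:
  fixes \<epsilon> :: real and n :: nat and c :: "nat \<Rightarrow> 'n::finite"
  assumes "\<epsilon> > 0" and "n = CARD('n)" and "n \<ge> 2"
    and "bij_betw c {1..n} (UNIV :: 'n set)"
  shows "open (R_eps c \<epsilon>) \<and> connected (R_eps c \<epsilon>) \<and>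
    (\<exists>m f. 1 \<le> m \<and> m \<le> n \<and>
       (\<forall>l\<in>{1..m}. smooth (f l)) \<and>
       preserves_constraints c \<epsilon> m f \<and>
       controllable (R_eps c \<epsilon>) m f) \<and>
    (\<forall>m. m \<le> n \<and> 2 * m \<ge> n + 1 \<longrightarrow>
       (\<exists>f. (\<forall>l\<in>{1..m}. smooth (f l)) \<and>
          preserves_constraints c \<epsilon> m f \<and>
          controllable (R_eps c \<epsilon>) m f \<and>
          (\<forall>l\<in>{1..m}. depends_only_on c {l - 1, l, m + l - 2, m + l - 1} (f l))))"
proof -
  interpret numbering c using assms by unfold_locales simp
  have fields: "(\<forall>l\<in>{1..m}. smooth (gap_field c \<epsilon> m l)) \<and>
      preserves_constraints c \<epsilon> m (gap_field c \<epsilon> m) \<and>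
      controllable (R_eps c \<epsilon>) m (gap_field c \<epsilon> m) \<and>
      (\<forall>l\<in>{1..m}. depends_only_on c {l - 1, l, m + l - 2, m + l - 1} (gap_field c \<epsilon> m l))"
    if "m \<le> n" "2 * m \<ge> n + 1" for m
    \<comment> \<open>From \<open>n \<ge> 2\<close> and \<open>2 * m \<ge> n + 1\<close> it follows
      that \<open>m \<ge> 2\<close>, as the lemmas require.\<close>
    using that assms(2,3)
    by (intro conjI ballI smooth_gap_field preserves_constraints_gap_field controllable_gap_field
        depends_only_on_gap_field) auto
  have "\<exists>m f. 1 \<le> m \<and> m \<le> n \<and> (\<forall>l\<in>{1..m}. smooth (f l)) \<and>
      preserves_constraints c \<epsilon> m f \<and> controllable (R_eps c \<epsilon>) m f"
    \<comment> \<open>The choice \<open>m = n\<close> satisfies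
      \<open>2 * m \<ge> n + 1\<close>.\<close>
    using fields[of n] assms(3) by (intro exI[of _ n] exI[of _ "gap_field c \<epsilon> n"]) auto
  moreover have "\<exists>f. (\<forall>l\<in>{1..m}. smooth (f l)) \<and> preserves_constraints c \<epsilon> m f \<and>
      controllable (R_eps c \<epsilon>) m f \<and>
      (\<forall>l\<in>{1..m}. depends_only_on c {l - 1, l, m + l - 2, m + l - 1} (f l))"
    if "m \<le> n \<and> 2 * m \<ge> n + 1" for m
    using fields[of m] that by (intro exI[of _ "gap_field c \<epsilon> m"]) simp
  ultimately show ?thesis using open_R_eps convex_connected[OF convex_R_eps] by (intro conjI allI impI)
qed

end
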